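(* Let $M$ be a co-Eulerian regular oriented matroid with (totally unimodular) representing matrix $A$. Denote the coefficient vector of the $h^*$-polynomial of $\mathcal{Q}_A$ by $h^*_A$. Let $\mathcal{D}$ be any dissecting set of bases for $M$, and take any fixed (linear) ordering of the elements of $M$. Then for every $i$, $$(h^*_A)_i=|\{B\in\mathcal{D}\mid B\text{ has exactly } i \text{ internally semi-passive elements}\}|.$$
   Context: **Regular oriented matroids.** A matrix is totally unimodular if all its subdeterminants are in $\{0,1,-1\}$. A totally unimodular matrix $A$ with columns $a_1,\dots,a_m\in\mathbb{Z}^n$ ($m\ge 1$) represents the regular oriented matroid $M$ on $\{1,\dots,m\}$ given as follows. A set of indices is independent if the corresponding family of columns is linearly independent; bases are maximal independent sets; circuits are minimal dependent sets. A signed circuit is $(C^+,C^-)$ with $C=C^+\sqcup C^-$ a circuit having a linear dependence $\sum_{i\in C}\lambda_ia_i=0$ with $\lambda_i>0$ on $C^+$ and $\lambda_i<0$ on $C^-$ (the partition is unique up to swapping the two parts). A cocircuit is an inclusion-minimal nonempty set $C^*$ of the form $\{i: h(a_i)\ne 0\}$ for a linear functional $h$ on $\mathbb{R}^n$; it is signed by $(C^* )^+=\{i:h(a_i)>0\}$, $(C^* )^-=\{i:h(a_i)<0\}$ (well defined up to swapping). Two elements of $C^*$ have the same sign if they lie in the same part, and opposite signs otherwise. $M$ is co-Eulerian if $|C^+|=|C^-|$ for every circuit $C$. **Dissecting sets of bases.** $\mathcal{Q}_A=\mathrm{Conv}\{a_1,\dots,a_m\}$ is the root polytope. For a basis $B$,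 let $\Delta_B=\mathrm{Conv}\{a_i:i\in B\}$; in the co-Eulerian case this is a simplex of dimension $\dim\mathcal{Q}_A$. A set $\mathcal{D}$ of bases is a dissecting set of bases if $\mathcal{Q}_A=\bigcup_{B\in\mathcal{D}}\Delta_B$ and the simplices $\Delta_B$, for distinct $B\in\mathcal{D}$, have pairwise disjoint relative interiors. **Internal semi-passivity.** For a basis $B$ and $e\in B$, the fundamental cocircuit $C^*(B,e)$ is the unique cocircuit contained in the complement of $B-e$. With respect to a fixed ordering of the elements, $e\in B$ is internally semi-active for $B$ if the maximal element of $C^*(B,e)$ has the same sign as $e$ in $C^*(B,e)$, and internally semi-passive for $B$ if the maximal element has the opposite sign to $e$. **$h^*$-polynomial.** For a $d$-dimensional lattice polytope $P\subset\mathbb{R}^n$, the Ehrhart polynomial is $\varepsilon_P(t)=|tP\cap\mathbb{Z}^n|$, $t\in\mathbb{N}$. Writing $\varepsilon_P(t)=\sum_{k=0}^d c_k\binom{t+d-k}{d}$, the $h^*$-polynomial is $\sum_{k=0}^d c_kx^k$, with coefficients $h^*_k=c_k$ (and $h^*_k=0$ for $k>d$). *)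

theory Defs
  imports "Jordan_Normal_Form.Determinant" "HOL-Analysis.Analysis"
begin

no_notation Matrix.vec_index (infixl \<open>$\<close> 100)
no_notation Matrix.scalar_prod (infix \<open>\<bullet>\<close> 70)

text \<open>
  A matrix \<open>A :: real ^ 'm ^ 'n\<close> has its rows indexed by the finite type \<open>'n\<close> and its columns by
  the finite type \<open>'m\<close>; the ground set of the oriented matroid is the index type \<open>'m\<close> (not the set
  of columns, since distinct indices may have equal columns).

  The \<open>k \<times> k\<close> submatrices are formed along injective enumerations of \<open>k\<close> rows and \<open>k\<close> columns, so
  they are not required to keep the order of rows and columns; this affects only the sign of the
  determinant. The case \<open>k = 1\<close> forces all entries, hence all columns, to be integral.
\<close>

definition totally_unimodular :: "real ^ 'm ^ 'n \<Rightarrow> bool" where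
  "totally_unimodular A \<longleftrightarrow>
    (\<forall>k (f :: nat \<Rightarrow> 'n) (g :: nat \<Rightarrow> 'm). inj_on f {..<k} \<and> inj_on g {..<k} \<longrightarrow>
      Determinant.det (Matrix.mat k k (\<lambda>(p, q). A $ f p $ g q)) \<in> {0, 1, -1})"

subsection \<open>The regular oriented matroid of a matrix\<close>

text \<open>
  Linear independence of the family of columns, which differs from \<^const>\<open>independent\<close> for the set
  of columns when columns are repeated.
\<close>

definition indep_columns :: "real ^ 'm ^ 'n \<Rightarrow> 'm set \<Rightarrow> bool" where
  "indep_columns A S \<longleftrightarrow>
    (\<forall>c :: 'm \<Rightarrow> real. (\<Sum>i\<in>S. c i *\<^sub>R column i A) = 0 \<longrightarrow> (\<forall>i\<in>S. c i = 0))"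

definition matroid_basis :: "real ^ 'm ^ 'n \<Rightarrow> 'm set \<Rightarrow> bool" where
  "matroid_basis A B \<longleftrightarrow> indep_columns A B \<and> (\<forall>B'. B \<subset> B' \<longrightarrow> \<not> indep_columns A B')"

definition circuit :: "real ^ 'm ^ 'n \<Rightarrow> 'm set \<Rightarrow> bool" where
  "circuit A C \<longleftrightarrow> \<not> indep_columns A C \<and> (\<forall>C'. C' \<subset> C \<longrightarrow> indep_columns A C')"

definition signed_circuit :: "real ^ 'm ^ 'n \<Rightarrow> 'm set \<Rightarrow> 'm set \<Rightarrow> bool" where
  "signed_circuit A P N \<longleftrightarrow>
    circuit A (P \<union> N) \<and> P \<inter> N = {} \<and>
    (\<exists>c :: 'm \<Rightarrow> real. (\<Sum>i\<in>P \<union> N. c i *\<^sub>R column i A) = 0 \<and>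
      (\<forall>i\<in>P. c i > 0) \<and> (\<forall>i\<in>N. c i < 0))"

definition co_eulerian :: "real ^ 'm ^ 'n \<Rightarrow> bool" where
  "co_eulerian A \<longleftrightarrow> (\<forall>P N. signed_circuit A P N \<longrightarrow> card P = card N)"

definition functional_support :: "real ^ 'm ^ 'n \<Rightarrow> (real ^ 'n \<Rightarrow> real) \<Rightarrow> 'm set" where
  "functional_support A h = {i. h (column i A) \<noteq> 0}"

definition cocircuit :: "real ^ 'm ^ 'n \<Rightarrow> 'm set \<Rightarrow> bool" where
  "cocircuit A C \<longleftrightarrow>
    C \<noteq> {} \<and> (\<exists>h. linear h \<and> C = functional_support A h) \<and>
    (\<forall>h. linear h \<and> functional_support A h \<noteq> {} \<longrightarrow> \<not> functional_support A h \<subset> C)"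

definition signed_cocircuit :: "real ^ 'm ^ 'n \<Rightarrow> 'm set \<Rightarrow> 'm set \<Rightarrow> bool" where
  "signed_cocircuit A P N \<longleftrightarrow>
    cocircuit A (P \<union> N) \<and>
    (\<exists>h :: real ^ 'n \<Rightarrow> real. linear h \<and>
      P = {i. h (column i A) > 0} \<and> N = {i. h (column i A) < 0})"

definition same_sign :: "real ^ 'm ^ 'n \<Rightarrow> 'm set \<Rightarrow> 'm \<Rightarrow> 'm \<Rightarrow> bool" where
  "same_sign A C e f \<longleftrightarrow>
    (\<exists>P N. signed_cocircuit A P N \<and> P \<union> N = C \<and> (e \<in> P \<and> f \<in> P \<or> e \<in> N \<and> f \<in> N))"

definition opposite_sign :: "real ^ 'm ^ 'n \<Rightarrow> 'm set \<Rightarrow> 'm \<Rightarrow> 'm \<Rightarrow> bool" where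
  "opposite_sign A C e f \<longleftrightarrow> e \<in> C \<and> f \<in> C \<and> \<not> same_sign A C e f"

definition fundamental_cocircuit :: "real ^ 'm ^ 'n \<Rightarrow> 'm set \<Rightarrow> 'm \<Rightarrow> 'm set" where
  "fundamental_cocircuit A B e = (THE C. cocircuit A C \<and> C \<subseteq> - (B - {e}))"

text \<open>A pair \<open>(x, y) \<in> r\<close> means that \<open>x\<close> is less than or equal to \<open>y\<close>.\<close>

definition max_element :: "'m rel \<Rightarrow> 'm set \<Rightarrow> 'm" where
  "max_element r C = (THE m. m \<in> C \<and> (\<forall>x\<in>C. (x, m) \<in> r))"

definition internally_semi_passive ::
    "real ^ 'm ^ 'n \<Rightarrow> 'm rel \<Rightarrow> 'm set \<Rightarrow> 'm \<Rightarrow> bool" where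
  "internally_semi_passive A r B e \<longleftrightarrow>
    e \<in> B \<and>
    opposite_sign A (fundamental_cocircuit A B e) e (max_element r (fundamental_cocircuit A B e))"

subsection \<open>Root polytope and dissections\<close>

definition root_polytope :: "real ^ 'm ^ 'n \<Rightarrow> (real ^ 'n) set" where
  "root_polytope A = convex hull (range (\<lambda>i. column i A))"

definition basis_simplex :: "real ^ 'm ^ 'n \<Rightarrow> 'm set \<Rightarrow> (real ^ 'n) set" where
  "basis_simplex A B = convex hull ((\<lambda>i. column i A) ` B)"

definition dissecting_bases :: "real ^ 'm ^ 'n \<Rightarrow> 'm set set \<Rightarrow> bool" where
  "dissecting_bases A D \<longleftrightarrow>
    (\<forall>B\<in>D. matroid_basis A B) \<and>
    root_polytope A = (\<Union>B\<in>D. basis_simplex A B) \<and>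
    (\<forall>B\<in>D. \<forall>B'\<in>D. B \<noteq> B' \<longrightarrow>
      rel_interior (basis_simplex A B) \<inter> rel_interior (basis_simplex A B') = {})"

subsection \<open>The \<open>h\<^sup>*\<close>-polynomial\<close>

definition integer_lattice :: "(real ^ 'n) set" where
  "integer_lattice = {x. \<forall>j. x $ j \<in> \<int>}"

definition ehrhart :: "(real ^ 'n) set \<Rightarrow> nat \<Rightarrow> nat" where
  "ehrhart P t = card ((\<lambda>x. real t *\<^sub>R x) ` P \<inter> integer_lattice)"

text \<open>
  For \<open>k \<le> d\<close> the truncated subtraction in \<open>t + d - k\<close> is exact and the binomial coefficient
  on \<^typ>\<open>nat\<close> agrees with the polynomial one. Evaluating at \<open>t = 0, \<dots>, d\<close> gives a unitriangular
  system, so there is at most one such polynomial; existence for lattice polytopes is Ehrhart's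
  theorem.
\<close>

definition h_star_poly :: "(real ^ 'n) set \<Rightarrow> real poly" where
  "h_star_poly P = (let d = nat (aff_dim P) in
    THE p. degree p \<le> d \<and>
      (\<forall>t. real (ehrhart P t) = (\<Sum>k\<le>d. coeff p k * real ((t + d - k) choose d))))"

end

theory Submission
  imports Defs
begin

text \<open>
  Since \<open>A\<close> is totally unimodular, the columns \<open>a\<^sub>e\<close> with \<open>e\<close> in a basis \<open>B\<close> form a lattice basis
  of the integer points in their span: each coordinate function with respect to \<open>B\<close> is given by an
  integral vector (\<open>integral_dual_vector_exists\<close>). Its values on the columns are \<open>0\<close> and
  \<open>\<plusminus>1\<close>, and the support of the coordinate of \<open>e\<close> is the fundamental cocircuit
  \<open>C\<^sup>*(B, e)\<close>, with signs given by the sign of the coordinate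
  (\<open>opposite_sign_fundamental_cocircuit_iff\<close>). The co-Eulerian condition, applied to fundamental
  circuits, says that the coordinates of every column sum to \<open>1\<close>, so all columns lie on a
  hyperplane at height \<open>1\<close> and every \<open>\<Delta>\<^sub>B\<close> is a unimodular simplex of dimension
  \<open>d = card B - 1\<close>.

  The semi-passive elements are encoded in one vector. Let \<open>q\<close> be the positive combination of the
  columns in which each element has a weight larger than the sum of the weights of all smaller
  elements. The coordinate of \<open>q\<close> at \<open>e\<close> is then dominated by the maximal element of
  \<open>C\<^sup>*(B, e)\<close>; it is nonzero for all \<open>B\<close> and \<open>e\<close>, and it is negative exactly when \<open>e\<close> is
  internally semi-passive for \<open>B\<close> (\<open>internally_semi_passive_iff\<close>).

  Now move every point \<open>x\<close> of the dilated polytope slightly in the direction \<open>q\<close>, and assign to it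
  the simplex that contains the moved point. Because \<open>q\<close> is generic, the moved point lies in the
  relative interior of that simplex, so in a dissection the simplex is unique
  (\<open>ex1_half_open\<close>). This is a half-open decomposition: the part belonging to \<open>B\<close> is the
  simplex \<open>\<Delta>\<^sub>B\<close> without the facets opposite to the semi-passive elements. Simplices that
  overlap in their boundaries without sharing a face cause no trouble, because only relative
  interiors are compared; this is why the argument covers dissections. If \<open>B\<close> has
  \<open>p\<close> semi-passive elements, the lattice points of its part of the \<open>t\<close>-th dilation are the
  nonnegative integral coordinate vectors of sum \<open>t\<close> that are positive at \<open>p\<close> given places, and
  there are \<open>(t + d - p) choose d\<close> of them (\<open>card_half_open_lattice_points\<close>). Summing over the
  dissection expands the Ehrhart polynomial in the binomial basis that defines
  \<open>h\<^sup>*\<close>, and the coefficients in that basis are unique.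
\<close>

section \<open>Integral dual bases of a totally unimodular matrix\<close>

lemma totally_unimodular_entry_integral:
  fixes A :: "real ^ 'm ^ 'n"
  assumes "totally_unimodular A"
  shows "A $ i $ j \<in> \<int>"
proof -
  have "Determinant.det (Matrix.mat 1 1 (\<lambda>(p, q). A $ ((\<lambda>_. i) p) $ ((\<lambda>_. j) q))) \<in> {0, 1, -1}"
    using assms unfolding totally_unimodular_def
    by (elim allE[where x = 1] allE[where x = "\<lambda>_. i"] allE[where x = "\<lambda>_. j"]) (auto simp: inj_on_def)
  then show ?thesis
    by (subst (asm) det_single) auto
qed

lemma det_integral:
  fixes M :: "real mat"
  assumes "\<And>i j. i < dim_row M \<Longrightarrow> j < dim_col M \<Longrightarrow> M $$ (i, j) \<in> \<int>"
  shows "Determinant.det M \<in> \<int>"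
proof -
  have "M $$ (i, p i) \<in> \<int>" if "dim_row M = dim_col M" "p permutes {0..<dim_row M}" "i < dim_row M" for p i
    using permutes_in_image[OF that(2), of i] that by (intro assms) auto
  then show ?thesis
    unfolding Determinant.det_def
    by (auto intro!: Ints_sum Ints_mult Ints_prod simp: sign_def)
qed

text \<open>
  The inverse of an integral matrix of determinant \<open>\<plusminus>1\<close> is its adjugate up to sign. The inverse is
  stated as a function so that it can be used outside the matrix type.
\<close>

lemma left_inverse_integral:
  fixes M :: "real mat"
  assumes M: "M \<in> carrier_mat k k"
    and int: "\<And>i j. i < k \<Longrightarrow> j < k \<Longrightarrow> M $$ (i, j) \<in> \<int>"
    and det: "Determinant.det M \<in> {1, -1}"
  obtains U where "\<And>p q. p < k \<Longrightarrow> q < k \<Longrightarrow> U q p \<in> \<int>"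
    and "\<And>q0 q. q0 < k \<Longrightarrow> q < k \<Longrightarrow> (\<Sum>p<k. U q0 p * M $$ (p, q)) = (if q = q0 then 1 else 0)"
proof -
  define U where "U q p = Determinant.det M * adj_mat M $$ (q, p)" for q p
  have dM: "dim_row M = k" "dim_col M = k" using M by auto
  have int_U: "U q p \<in> \<int>" if "p < k" "q < k" for p q
  proof -
    have "Determinant.det (mat_delete M p q) \<in> \<int>"
      by (rule det_integral) (use that dM in \<open>auto simp: mat_delete_def intro!: int\<close>)
    then show ?thesis
      using that det dM unfolding U_def adj_mat_def cofactor_def by (auto intro!: Ints_mult)
  qed
  have inv_U: "(\<Sum>p<k. U q0 p * M $$ (p, q)) = (if q = q0 then 1 else 0)" if "q0 < k" "q < k" for q0 q
  proof -
    have c: "adj_mat M \<in> carrier_mat k k" using adj_mat(1)[OF M] .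
    have "(\<Sum>p<k. U q0 p * M $$ (p, q)) = Determinant.det M * (\<Sum>p<k. adj_mat M $$ (q0, p) * M $$ (p, q))"
      by (simp add: U_def sum_distrib_left mult_ac)
    also have "(\<Sum>p<k. adj_mat M $$ (q0, p) * M $$ (p, q)) = (adj_mat M * M) $$ (q0, q)"
      using that c dM by (simp add: times_mat_def scalar_prod_def atLeast0LessThan)
    also have "\<dots> = (if q = q0 then Determinant.det M else 0)"
      using that unfolding adj_mat(3)[OF M] by auto
    finally show ?thesis using det by auto
  qed
  show thesis using that[of U] int_U inv_U by blast
qed

text \<open>
  The rows, restricted to the columns in \<open>B\<close>, span the whole coordinate space of \<open>B\<close>: a nonzero
  vector orthogonal to all of them would be a linear dependence of the columns. A basis chosen among
  the restricted rows therefore has exactly \<open>card B\<close> elements and gives a nonsingular square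
  submatrix.
\<close>

lemma nonzero_minor_exists:
  fixes A :: "real ^ 'm ^ 'n"
  assumes indep: "indep_columns A B"
  obtains f :: "nat \<Rightarrow> 'n" and g :: "nat \<Rightarrow> 'm"
  where "inj_on f {..<card B}" "bij_betw g {..<card B} B"
    and "Determinant.det (Matrix.mat (card B) (card B) (\<lambda>(p, q). A $ f p $ g q)) \<noteq> 0"
proof -
  define k where "k = card B"
  \<comment> \<open>Extending the restricted rows by zero keeps them in a Euclidean space, where orthogonal
      complements are available; \<open>W\<close> is the coordinate space of \<open>B\<close> there.\<close>
  define \<rho> :: "'n \<Rightarrow> real ^ 'm" where "\<rho> j = (\<chi> i. if i \<in> B then A $ j $ i else 0)" for j
  define W :: "(real ^ 'm) set" where "W = {x. \<forall>i. i \<notin> B \<longrightarrow> x $ i = 0}"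
  have W: "subspace W" unfolding W_def by (auto simp: subspace_def)
  have rW: "range \<rho> \<subseteq> W" by (auto simp: \<rho>_def W_def)
  have inner: "\<rho> j \<bullet> x = (\<Sum>i\<in>B. x $ i * A $ j $ i)" for j x
  proof -
    have "\<rho> j \<bullet> x = (\<Sum>i\<in>UNIV. if i \<in> B then x $ i * A $ j $ i else 0)"
      by (auto simp: inner_vec_def \<rho>_def intro!: sum.cong)
    also have "\<dots> = (\<Sum>i\<in>B. x $ i * A $ j $ i)" by (simp add: sum.If_cases)
    finally show ?thesis .
  qed
  have span_W: "span W = W" using W by simp
  have "span (range \<rho>) = W"
  proof (rule ccontr)
    assume "span (range \<rho>) \<noteq> W"
    then have "span (range \<rho>) \<subset> span W"
      using span_minimal[OF rW W] unfolding span_W by blast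
    then obtain x where x: "x \<noteq> 0" "x \<in> span W" "\<And>y. y \<in> span (range \<rho>) \<Longrightarrow> orthogonal x y"
      using orthogonal_to_subspace_exists_gen by blast
    have "(\<Sum>i\<in>B. x $ i * A $ j $ i) = 0" for j
      using x(3)[of "\<rho> j"] inner[of j x] by (simp add: orthogonal_def span_base inner_commute)
    then have "(\<Sum>i\<in>B. x $ i *\<^sub>R column i A) = 0"
      by (simp add: vec_eq_iff column_def)
    then have "\<forall>i\<in>B. x $ i = 0"
      using indep unfolding indep_columns_def by blast
    moreover have "x \<in> W" using x(2) W by (metis span_eq_iff)
    ultimately have "x = 0" by (auto simp: W_def vec_eq_iff)
    then show False using x(1) by simp
  qed
  moreover obtain R where R: "R \<subseteq> range \<rho>" "independent R" "range \<rho> \<subseteq> span R" "card R = dim (range \<rho>)"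
    using basis_exists by blast
  ultimately have sR: "span R = W"
    by (metis span_mono span_span subset_antisym)
  have "dim W = card B"
    unfolding W_def dim_vec_eq[symmetric] by (rule dim_substandard_cart)
  then have cR: "card R = k"
    using R sR k_def by (metis dim_span dim_eq_card_independent)
  have "finite R" using R(2) by (simp add: independent_imp_finite)
  then obtain b where b: "bij_betw b {..<k} R"
    using cR ex_bij_betw_nat_finite[of R] by (auto simp: atLeast0LessThan)
  obtain g where g: "bij_betw g {..<k} B"
    using ex_bij_betw_nat_finite[of B] k_def by (auto simp: atLeast0LessThan)
  have "\<exists>j. \<rho> j = b p" if "p < k" for p
    using b R(1) that unfolding bij_betw_def by fastforce
  then obtain f where f: "\<And>p. p < k \<Longrightarrow> \<rho> (f p) = b p" by metis
  have injf: "inj_on f {..<k}"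
    using b f unfolding bij_betw_def inj_on_def by (metis lessThan_iff)
  define M where "M = Matrix.mat k k (\<lambda>(p, q). A $ f p $ g q)"
  have M: "M \<in> carrier_mat k k" by (simp add: M_def)
  \<comment> \<open>A kernel vector of \<open>M\<close>, seen as an element \<open>x\<close> of \<open>W\<close>, is orthogonal to the spanning
      set \<open>R\<close> of \<open>W\<close>, hence to itself.\<close>
  have "Determinant.det M \<noteq> 0"
  proof
    assume "Determinant.det M = 0"
    then obtain v where v: "v \<in> carrier_vec k" "v \<noteq> 0\<^sub>v k" "M *\<^sub>v v = 0\<^sub>v k"
      using det_0_iff_vec_prod_zero[OF M] by blast
    define h where "h = inv_into {..<k} g"
    have hg: "h (g q) = q" if "q < k" for q
      using g that unfolding h_def bij_betw_def by simp
    define x :: "real ^ 'm" where "x = (\<chi> i. if i \<in> B then vec_index v (h i) else 0)"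
    have xW: "x \<in> W" by (simp add: x_def W_def)
    have "\<rho> (f p) \<bullet> x = 0" if p: "p < k" for p
    proof -
      have "\<rho> (f p) \<bullet> x = (\<Sum>q<k. x $ g q * A $ f p $ g q)"
        unfolding inner using sum.reindex_bij_betw[OF g, of "\<lambda>i. x $ i * A $ f p $ i"] by simp
      also have "\<dots> = (\<Sum>q<k. A $ f p $ g q * vec_index v q)"
        using g hg by (intro sum.cong) (auto simp: x_def bij_betw_def)
      also have "\<dots> = vec_index (M *\<^sub>v v) p"
        using p v(1) by (auto simp: M_def scalar_prod_def atLeast0LessThan intro!: sum.cong)
      finally show ?thesis using v(3) p by simp
    qed
    then have "orthogonal x y" if "y \<in> R" for y
      using that b f unfolding bij_betw_def orthogonal_def by (metis imageE inner_commute lessThan_iff)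
    then have "orthogonal x x"
      using orthogonal_to_span[of x R x] xW sR by blast
    then have x0: "x = 0" by (simp add: orthogonal_self)
    have "vec_index v q = 0" if "q < k" for q
    proof -
      have "g q \<in> B" using g that by (auto simp: bij_betw_def)
      then show ?thesis using arg_cong[OF x0, of "\<lambda>x. x $ g q"] hg[OF that] by (simp add: x_def)
    qed
    then show False using v(1,2) by auto
  qed
  then show thesis using that injf g unfolding M_def k_def by blast
qed

text \<open>
  Total unimodularity makes the nonzero minor \<open>\<plusminus>1\<close>. The vector \<open>w\<close> is the row of the inverse
  submatrix that belongs to \<open>e\<close>, placed at the chosen rows and zero elsewhere.
\<close>

lemma integral_dual_vector_exists:
  fixes A :: "real ^ 'm ^ 'n"
  assumes tu: "totally_unimodular A" and indep: "indep_columns A B" and e: "e \<in> B"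
  shows "\<exists>w. (\<forall>j. w $ j \<in> \<int>) \<and> (\<forall>i\<in>B. w \<bullet> column i A = (if i = e then 1 else 0))"
proof -
  define k where "k = card B"
  obtain f g where f: "inj_on f {..<k}" and g: "bij_betw g {..<k} B"
    and det: "Determinant.det (Matrix.mat k k (\<lambda>(p, q). A $ f p $ g q)) \<noteq> 0"
    using nonzero_minor_exists[OF indep] unfolding k_def by blast
  define M where "M = Matrix.mat k k (\<lambda>(p, q). A $ f p $ g q)"
  have "Determinant.det M \<in> {0, 1, -1}"
    using tu f g unfolding totally_unimodular_def M_def bij_betw_def by blast
  then have det': "Determinant.det M \<in> {1, -1}" using det M_def by auto
  obtain U where U: "\<And>p q. p < k \<Longrightarrow> q < k \<Longrightarrow> U q p \<in> \<int>"
    "\<And>q0 q. q0 < k \<Longrightarrow> q < k \<Longrightarrow> (\<Sum>p<k. U q0 p * M $$ (p, q)) = (if q = q0 then 1 else 0)"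
    by (rule left_inverse_integral[OF _ _ det', of k])
      (auto simp: M_def totally_unimodular_entry_integral[OF tu])
  obtain q0 where q0: "q0 < k" "g q0 = e" using g e unfolding bij_betw_def by blast
  define w :: "real ^ 'n" where "w = (\<Sum>p<k. U q0 p *\<^sub>R axis (f p) 1)"
  have "w $ j \<in> \<int>" for j
    unfolding w_def sum_component using U(1) q0 by (auto intro!: Ints_sum Ints_mult simp: axis_def)
  moreover have "w \<bullet> column i A = (if i = e then 1 else 0)" if "i \<in> B" for i
  proof -
    obtain q where q: "q < k" "g q = i" using g \<open>i \<in> B\<close> unfolding bij_betw_def by blast
    have "w \<bullet> column i A = (\<Sum>p<k. U q0 p * M $$ (p, q))"
      using q by (auto simp: w_def inner_sum_left inner_axis' M_def column_def intro!: sum.cong)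
    also have "\<dots> = (if q = q0 then 1 else 0)" using U(2) q q0 by blast
    also have "\<dots> = (if i = e then 1 else 0)"
      using q q0 g by (auto simp: bij_betw_def inj_on_def)
    finally show ?thesis .
  qed
  ultimately show ?thesis by blast
qed

section \<open>Coordinates with respect to a matroid basis\<close>

lemma indep_columns_mono:
  assumes "indep_columns A T" "S \<subseteq> T"
  shows "indep_columns A S"
  unfolding indep_columns_def
proof (intro allI impI ballI)
  fix c :: "'a \<Rightarrow> real" and i
  assume c: "(\<Sum>i\<in>S. c i *\<^sub>R column i A) = 0" and i: "i \<in> S"
  define c' where "c' j = (if j \<in> S then c j else 0)" for j
  have "(\<Sum>j\<in>T. c' j *\<^sub>R column j A) = (\<Sum>j\<in>S. c j *\<^sub>R column j A)"
    using assms(2) by (intro sum.mono_neutral_cong_right) (auto simp: c'_def)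
  then have "\<forall>j\<in>T. c' j = 0"
    using assms(1) c unfolding indep_columns_def by simp
  then have "c' i = 0" using i assms(2) by blast
  then show "c i = 0" using i by (simp add: c'_def)
qed

text \<open>
  The conditions determine the vector only modulo the orthogonal complement of the columns in \<open>B\<close>.
  Its inner products with vectors in the span of those columns do not depend on the choice.
\<close>

definition dual_vector :: "real ^ 'm ^ 'n \<Rightarrow> 'm set \<Rightarrow> 'm \<Rightarrow> real ^ 'n" where
  "dual_vector A B e =
    (SOME w. (\<forall>j. w $ j \<in> \<int>) \<and> (\<forall>i\<in>B. w \<bullet> column i A = (if i = e then 1 else 0)))"

definition coord :: "real ^ 'm ^ 'n \<Rightarrow> 'm set \<Rightarrow> 'm \<Rightarrow> real ^ 'n \<Rightarrow> real" where
  "coord A B e x = dual_vector A B e \<bullet> x"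

lemma linear_coord: "linear (coord A B e)"
  unfolding coord_def by (rule bounded_linear.linear[OF bounded_linear_inner_right])

lemma coord_add: "coord A B e (x + y) = coord A B e x + coord A B e y"
  and coord_scaleR: "coord A B e (c *\<^sub>R x) = c * coord A B e x"
  and coord_sum: "coord A B e (\<Sum>i\<in>I. F i) = (\<Sum>i\<in>I. coord A B e (F i))"
  and coord_zero: "coord A B e 0 = 0"
  by (simp_all add: coord_def inner_add_right inner_sum_right)

locale totally_unimodular_matrix =
  fixes A :: "real ^ 'm ^ 'n"
  assumes totally_unimodular: "totally_unimodular A"
begin

abbreviation a :: "'m \<Rightarrow> real ^ 'n" where "a i \<equiv> column i A"

lemma dual_vector:
  assumes "indep_columns A B" "e \<in> B"
  shows "dual_vector A B e $ j \<in> \<int>"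
    and "i \<in> B \<Longrightarrow> dual_vector A B e \<bullet> a i = (if i = e then 1 else 0)"
proof -
  have "(\<forall>j. dual_vector A B e $ j \<in> \<int>) \<and>
      (\<forall>i\<in>B. dual_vector A B e \<bullet> a i = (if i = e then 1 else 0))"
    unfolding dual_vector_def
    by (rule someI_ex[OF integral_dual_vector_exists[OF totally_unimodular assms]])
  then show "dual_vector A B e $ j \<in> \<int>"
    and "i \<in> B \<Longrightarrow> dual_vector A B e \<bullet> a i = (if i = e then 1 else 0)"
    by simp_all
qed

lemma coord_column:
  assumes "indep_columns A B" "e \<in> B" "i \<in> B"
  shows "coord A B e (a i) = (if i = e then 1 else 0)"
  using dual_vector(2)[OF assms] by (simp add: coord_def)

lemma coord_integral:
  assumes "indep_columns A B" "e \<in> B" "x \<in> integer_lattice"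
  shows "coord A B e x \<in> \<int>"
proof -
  have "dual_vector A B e $ j * x $ j \<in> \<int>" for j
    using dual_vector(1)[OF assms(1,2)] assms(3) by (simp add: integer_lattice_def Ints_mult)
  then show ?thesis by (simp add: coord_def inner_vec_def Ints_sum)
qed

lemma column_integral: "a i \<in> integer_lattice"
  using totally_unimodular_entry_integral[OF totally_unimodular]
  by (simp add: integer_lattice_def column_def)

lemma coord_combination:
  assumes "indep_columns A B" "e \<in> B"
  shows "coord A B e (\<Sum>i\<in>B. c i *\<^sub>R a i) = c e"
proof -
  have "coord A B e (\<Sum>i\<in>B. c i *\<^sub>R a i) = (\<Sum>i\<in>B. if i = e then c e else 0)"
    unfolding coord_sum coord_scaleR by (intro sum.cong) (use assms in \<open>auto simp: coord_column\<close>)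
  then show ?thesis using assms(2) by simp
qed

context
  fixes B :: "'m set"
  assumes basis: "matroid_basis A B"
begin

lemma basis_indep: "indep_columns A B"
  using basis by (simp add: matroid_basis_def)

text \<open>
  By maximality of \<open>B\<close>, adding a further column creates a dependence, and the new column must
  occur in it.
\<close>

lemma column_in_basis_span: "a i \<in> span (a ` B)"
proof (cases "i \<in> B")
  case False
  then have "\<not> indep_columns A (insert i B)"
    using basis unfolding matroid_basis_def by blast
  then obtain c where c: "(\<Sum>j\<in>insert i B. c j *\<^sub>R a j) = 0" and nz: "\<exists>j\<in>insert i B. c j \<noteq> 0"
    unfolding indep_columns_def by blast
  have sum0: "c i *\<^sub>R a i + (\<Sum>j\<in>B. c j *\<^sub>R a j) = 0" using c False by simp
  have ci: "c i \<noteq> 0"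
  proof
    assume "c i = 0"
    then have "\<forall>j\<in>B. c j = 0" using sum0 basis_indep unfolding indep_columns_def by simp
    then show False using nz \<open>c i = 0\<close> by auto
  qed
  have "c i *\<^sub>R a i = - (\<Sum>j\<in>B. c j *\<^sub>R a j)" using sum0 by (simp add: eq_neg_iff_add_eq_0)
  also have "\<dots> \<in> span (a ` B)" by (intro span_neg span_sum span_scale span_base) auto
  finally have "(1 / c i) *\<^sub>R (c i *\<^sub>R a i) \<in> span (a ` B)" by (rule span_scale)
  then show ?thesis using ci by simp
qed (auto intro: span_base)

lemma basis_expansion:
  assumes "x \<in> span (range a)"
  shows "x = (\<Sum>e\<in>B. coord A B e x *\<^sub>R a e)"
proof -
  have "x \<in> span (a ` B)"
    using assms span_minimal[of "range a" "span (a ` B)"] column_in_basis_span by auto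
  then show ?thesis
  proof (induction rule: span_induct_alt)
    case base
    then show ?case by (simp add: coord_zero)
  next
    case (step c x y)
    then obtain i where i: "i \<in> B" "x = a i" by blast
    have "(\<Sum>e\<in>B. coord A B e (c *\<^sub>R x + y) *\<^sub>R a e) =
        (\<Sum>e\<in>B. (if e = i then c *\<^sub>R a e else 0) + coord A B e y *\<^sub>R a e)"
      by (intro sum.cong) (auto simp: coord_add coord_scaleR scaleR_add_left i coord_column basis_indep)
    also have "\<dots> = c *\<^sub>R x + y"
      using i step.IH by (simp add: sum.distrib)
    finally show ?case by simp
  qed
qed

lemma linear_expansion:
  assumes "x \<in> span (range a)" "linear h"
  shows "h x = (\<Sum>e\<in>B. coord A B e x *\<^sub>R h (a e))"
  by (subst basis_expansion[OF assms(1)]) (simp add: linear_sum[OF assms(2)] linear_scale[OF assms(2)])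

text \<open>
  Basis exchange. Applying the coordinate of \<open>e\<close> to a dependence isolates the coefficient of the new
  column.
\<close>

lemma exchange_indep:
  assumes e: "e \<in> B" and i: "i \<notin> B" and nz: "coord A B e (a i) \<noteq> 0"
  shows "indep_columns A (insert i (B - {e}))"
  unfolding indep_columns_def
proof (intro allI impI)
  fix c assume c: "(\<Sum>j\<in>insert i (B - {e}). c j *\<^sub>R a j) = 0"
  have sum0: "c i *\<^sub>R a i + (\<Sum>j\<in>B - {e}. c j *\<^sub>R a j) = 0" using c i by simp
  have "coord A B e (\<Sum>j\<in>B - {e}. c j *\<^sub>R a j) = 0"
    unfolding coord_sum coord_scaleR
    by (intro sum.neutral) (use e in \<open>auto simp: coord_column basis_indep\<close>)
  then have "c i * coord A B e (a i) = 0"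
    using arg_cong[OF sum0, of "coord A B e"] by (simp add: coord_add coord_scaleR coord_zero)
  then have "c i = 0" using nz by simp
  moreover from this have "(\<Sum>j\<in>B - {e}. c j *\<^sub>R a j) = 0" using sum0 by simp
  then have "\<forall>j\<in>B - {e}. c j = 0"
    using indep_columns_mono[OF basis_indep, of "B - {e}"] unfolding indep_columns_def by blast
  ultimately show "\<forall>j\<in>insert i (B - {e}). c j = 0" by simp
qed

text \<open>
  After exchanging \<open>e\<close> for \<open>i\<close>, the coordinate of \<open>a\<^sub>e\<close> at \<open>i\<close> is the inverse of the coordinate of
  \<open>a\<^sub>i\<close> at \<open>e\<close>. Both are integers, so they are \<open>\<plusminus>1\<close>.
\<close>

lemma coord_column_values:
  assumes e: "e \<in> B"
  shows "coord A B e (a i) \<in> {-1, 0, 1}"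
proof (cases "i \<in> B \<or> coord A B e (a i) = 0")
  case True
  then show ?thesis
  proof
    assume "i \<in> B"
    then show ?thesis by (simp add: coord_column[OF basis_indep e])
  qed simp
next
  case False
  define B' where "B' = insert i (B - {e})"
  have B': "indep_columns A B'" "i \<in> B'" using exchange_indep e False by (auto simp: B'_def)
  have "1 = coord A B' i (a i)" using coord_column[OF B' B'(2)] by simp
  also have "\<dots> = (\<Sum>f\<in>B. coord A B f (a i) * coord A B' i (a f))"
    using linear_expansion[OF span_base linear_coord, of "a i" A B' i] by simp
  also have "\<dots> = (\<Sum>f\<in>{e}. coord A B f (a i) * coord A B' i (a f))"
  proof (rule sum.mono_neutral_right)
    have "coord A B' i (a f) = 0" if "f \<in> B - {e}" for f
      using coord_column[OF B', of f] that False by (auto simp: B'_def)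
    then show "\<forall>f\<in>B - {e}. coord A B f (a i) * coord A B' i (a f) = 0" by simp
  qed (use e in auto)
  finally have prod: "coord A B e (a i) * coord A B' i (a e) = 1" by simp
  obtain m n :: int where "coord A B e (a i) = of_int m" "coord A B' i (a e) = of_int n"
    using coord_integral[OF basis_indep e column_integral] coord_integral[OF B' column_integral]
    by (metis Ints_cases)
  moreover from this have "m * n = 1" using prod by (simp flip: of_int_mult)
  ultimately show ?thesis using zmult_eq_1_iff by auto
qed

text \<open>
  The expansion of \<open>a\<^sub>i\<close> in the basis, with \<open>a\<^sub>i\<close> moved to the other side, is a dependence
  supported on the fundamental circuit. Minimality is basis exchange.
\<close>

lemma fundamental_circuit:
  assumes i: "i \<notin> B"
  shows "signed_circuit A {e\<in>B. coord A B e (a i) > 0} (insert i {e\<in>B. coord A B e (a i) < 0})"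
    (is "signed_circuit A ?P ?N")
proof -
  define c where "c e = (if e = i then -1 else coord A B e (a i))" for e
  have C: "?P \<union> ?N = insert i {e\<in>B. coord A B e (a i) \<noteq> 0}" by auto
  have "(\<Sum>e\<in>?P \<union> ?N. c e *\<^sub>R a e) = - a i + (\<Sum>e | e \<in> B \<and> coord A B e (a i) \<noteq> 0. c e *\<^sub>R a e)"
    unfolding C using i by (subst sum.insert) (auto simp: c_def)
  also have "(\<Sum>e | e \<in> B \<and> coord A B e (a i) \<noteq> 0. c e *\<^sub>R a e) = (\<Sum>e\<in>B. coord A B e (a i) *\<^sub>R a e)"
    using i by (intro sum.mono_neutral_cong_left) (auto simp: c_def)
  also have "- a i + \<dots> = 0"
    using basis_expansion[OF span_base, of "a i"] by simp
  finally have dep: "(\<Sum>e\<in>?P \<union> ?N. c e *\<^sub>R a e) = 0" .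
  have "circuit A (?P \<union> ?N)"
    unfolding circuit_def
  proof (intro conjI allI impI notI)
    assume "indep_columns A (?P \<union> ?N)"
    then have "c i = 0" using dep unfolding indep_columns_def by blast
    then show False by (simp add: c_def)
  next
    fix C' assume C': "C' \<subset> ?P \<union> ?N"
    show "indep_columns A C'"
    proof (cases "i \<in> C'")
      case False
      then have "C' \<subseteq> B" using C' by auto
      then show ?thesis using basis_indep indep_columns_mono by blast
    next
      case True
      then obtain e where e: "e \<in> B" "coord A B e (a i) \<noteq> 0" "e \<notin> C'" using C' unfolding C by blast
      then have "C' \<subseteq> insert i (B - {e})" using C' by auto
      then show ?thesis using exchange_indep[OF e(1) i e(2)] indep_columns_mono by blast
    qed
  qed
  moreover have "?P \<inter> ?N = {}" "\<forall>e\<in>?P. c e > 0" "\<forall>e\<in>?N. c e < 0"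
    using i by (auto simp: c_def)
  ultimately show ?thesis using dep unfolding signed_circuit_def by blast
qed

text \<open>
  As the coordinates are \<open>0\<close> and \<open>\<plusminus>1\<close>, their sum is the number of positive ones minus the number
  of negative ones. In the fundamental circuit, \<open>i\<close> itself lies on the side of the negative
  coordinates, which balances the two sides only if this difference is \<open>1\<close>.
\<close>

lemma co_eulerian_coord_sum_column:
  assumes "co_eulerian A"
  shows "(\<Sum>e\<in>B. coord A B e (a i)) = 1"
proof (cases "i \<in> B")
  case True
  have "(\<Sum>e\<in>B. coord A B e (a i)) = (\<Sum>e\<in>B. if i = e then 1 else 0)"
    by (intro sum.cong) (use True in \<open>auto simp: coord_column basis_indep\<close>)
  then show ?thesis using True by simp
next
  case False
  let ?P = "{e\<in>B. coord A B e (a i) > 0}" and ?M = "{e\<in>B. coord A B e (a i) < 0}"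
  have "card ?P = card (insert i ?M)"
    using fundamental_circuit[OF False] assms unfolding co_eulerian_def by blast
  then have card: "card ?P = Suc (card ?M)" using False by simp
  have "(\<Sum>e\<in>B. coord A B e (a i)) = (\<Sum>e\<in>B. (if coord A B e (a i) > 0 then 1 else 0) -
      (if coord A B e (a i) < 0 then 1 else 0))"
    using coord_column_values by (intro sum.cong) force+
  also have "\<dots> = real (card ?P) - real (card ?M)"
    by (simp add: sum_subtractf sum.If_cases Int_def)
  finally show ?thesis using card by simp
qed

end

end

section \<open>Fundamental cocircuits and their signs\<close>

context totally_unimodular_matrix
begin

context
  fixes B :: "'m set"
  assumes basis: "matroid_basis A B"
begin

text \<open>
  A functional is determined on the columns by its values on the basis. Hence, up to a scalar, the
  coordinate of \<open>e\<close> is the only one that vanishes on \<open>B - {e}\<close>; uniqueness of the fundamental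
  cocircuit and of its signs both come from this.
\<close>

lemma linear_vanishing_on_rest_of_basis:
  assumes e: "e \<in> B" and h: "linear h" and zero: "\<And>f. f \<in> B - {e} \<Longrightarrow> h (a f) = 0"
  shows "h (a i) = h (a e) * coord A B e (a i)"
proof -
  have "h (a i) = (\<Sum>f\<in>B. coord A B f (a i) *\<^sub>R h (a f))"
    by (rule linear_expansion[OF basis _ h]) (simp add: span_base)
  also have "\<dots> = (\<Sum>f\<in>{e}. coord A B f (a i) *\<^sub>R h (a f))"
    by (rule sum.mono_neutral_right) (use e zero in auto)
  finally show ?thesis by simp
qed

lemma linear_vanishing_off_coord_support:
  assumes e: "e \<in> B" and h: "linear h" "functional_support A h \<subseteq> - (B - {e})"
  shows "h (a i) = h (a e) * coord A B e (a i)"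
  using h(2) by (intro linear_vanishing_on_rest_of_basis e h) (auto simp: functional_support_def)

lemma coord_support_subset:
  assumes "e \<in> B"
  shows "functional_support A (coord A B e) \<subseteq> - (B - {e})"
  using coord_column[OF basis_indep[OF basis] assms] by (auto simp: functional_support_def)

lemma coord_self: "e \<in> B \<Longrightarrow> coord A B e (a e) = 1"
  by (simp add: coord_column basis_indep[OF basis])

lemma functional_support_eq_coord_support:
  assumes e: "e \<in> B" and h: "linear h" "functional_support A h \<subseteq> - (B - {e})" "functional_support A h \<noteq> {}"
  shows "functional_support A h = functional_support A (coord A B e)"
proof -
  have eq: "h (a i) = h (a e) * coord A B e (a i)" for i
    using linear_vanishing_off_coord_support[OF e h(1,2)] .
  obtain i where "h (a i) \<noteq> 0" using h(3) by (auto simp: functional_support_def)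
  then have "h (a e) \<noteq> 0" using eq[of i] by auto
  then have "h (a i) = 0 \<longleftrightarrow> coord A B e (a i) = 0" for i
    by (subst eq) simp
  then show ?thesis by (simp add: functional_support_def)
qed

lemma cocircuit_coord_support:
  assumes e: "e \<in> B"
  shows "cocircuit A (functional_support A (coord A B e))"
  unfolding cocircuit_def
proof (intro conjI allI impI notI)
  assume "functional_support A (coord A B e) = {}"
  then show False using coord_self[OF e] by (auto simp: functional_support_def)
next
  fix h assume h: "linear h \<and> functional_support A h \<noteq> {}"
    and sub: "functional_support A h \<subset> functional_support A (coord A B e)"
  then have "functional_support A h \<subseteq> - (B - {e})" using coord_support_subset[OF e] by blast
  then show False using functional_support_eq_coord_support[OF e, of h] h sub by blast
qed (use linear_coord in blast)

lemma fundamental_cocircuit_eq: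
  assumes e: "e \<in> B"
  shows "fundamental_cocircuit A B e = functional_support A (coord A B e)"
  unfolding fundamental_cocircuit_def
proof (rule the_equality)
  fix C assume C: "cocircuit A C \<and> C \<subseteq> - (B - {e})"
  then obtain h where "linear h" "C = functional_support A h" "C \<noteq> {}"
    unfolding cocircuit_def by blast
  then show "C = functional_support A (coord A B e)"
    using functional_support_eq_coord_support[OF e, of h] C by blast
qed (use cocircuit_coord_support[OF e] coord_support_subset[OF e] in blast)

text \<open>
  The coordinate of \<open>e\<close> is \<open>1\<close> at \<open>e\<close>, so having the same sign as \<open>e\<close> means being positive there.
\<close>

lemma same_sign_fundamental_cocircuit_iff:
  assumes e: "e \<in> B" and f: "f \<in> fundamental_cocircuit A B e"
  shows "same_sign A (fundamental_cocircuit A B e) e f \<longleftrightarrow> coord A B e (a f) > 0"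
proof
  assume "same_sign A (fundamental_cocircuit A B e) e f"
  then obtain P N where PN: "signed_cocircuit A P N" "P \<union> N = fundamental_cocircuit A B e"
    "e \<in> P \<and> f \<in> P \<or> e \<in> N \<and> f \<in> N"
    unfolding same_sign_def by blast
  then obtain h :: "real ^ 'n \<Rightarrow> real" where h: "linear h" and "P = {i. h (a i) > 0}" "N = {i. h (a i) < 0}"
    unfolding signed_cocircuit_def by blast
  with PN have C: "fundamental_cocircuit A B e = {i. h (a i) > 0} \<union> {i. h (a i) < 0}"
    and s: "h (a e) > 0 \<and> h (a f) > 0 \<or> h (a e) < 0 \<and> h (a f) < 0"
    by auto
  have "functional_support A h = fundamental_cocircuit A B e"
    unfolding C functional_support_def by auto
  then have "h (a f) = h (a e) * coord A B e (a f)"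
    by (intro linear_vanishing_off_coord_support[OF e h])
      (simp only: fundamental_cocircuit_eq[OF e] coord_support_subset[OF e])
  then show "coord A B e (a f) > 0"
    using s by (auto simp: zero_less_mult_iff mult_less_0_iff)
next
  assume pos: "coord A B e (a f) > 0"
  let ?P = "{i. coord A B e (a i) > 0}" and ?N = "{i. coord A B e (a i) < 0}"
  have C: "?P \<union> ?N = fundamental_cocircuit A B e"
    unfolding fundamental_cocircuit_eq[OF e] functional_support_def by auto
  have "signed_cocircuit A ?P ?N"
    unfolding signed_cocircuit_def C
    using cocircuit_coord_support[OF e] linear_coord fundamental_cocircuit_eq[OF e] by auto
  moreover have "e \<in> ?P" "f \<in> ?P" using pos coord_self[OF e] by auto
  ultimately show "same_sign A (fundamental_cocircuit A B e) e f"
    unfolding same_sign_def using C by blast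
qed

lemma opposite_sign_fundamental_cocircuit_iff:
  assumes e: "e \<in> B" and f: "f \<in> fundamental_cocircuit A B e"
  shows "opposite_sign A (fundamental_cocircuit A B e) e f \<longleftrightarrow> coord A B e (a f) < 0"
proof -
  have "e \<in> fundamental_cocircuit A B e" "coord A B e (a f) \<noteq> 0"
    using f coord_self[OF e] by (auto simp: fundamental_cocircuit_eq[OF e] functional_support_def)
  then show ?thesis
    unfolding opposite_sign_def same_sign_fundamental_cocircuit_iff[OF assms] using f by auto
qed

end

end

section \<open>Basis simplices\<close>

context totally_unimodular_matrix
begin

context
  fixes B :: "'m set"
  assumes basis: "matroid_basis A B"
begin

lemma inj_on_column_basis: "inj_on a B"
proof (rule inj_onI)
  fix i j assume ij: "i \<in> B" "j \<in> B" "a i = a j"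
  have "(if j = i then 1 else 0) = (1 :: real)"
    by (metis coord_self[OF basis ij(1)] coord_column[OF basis_indep[OF basis] ij(1,2)] ij(3))
  then show "i = j" by (simp split: if_splits)
qed

lemma independent_basis_columns: "independent (a ` B)"
  unfolding independent_explicit_finite_subsets
proof (intro allI impI ballI)
  fix S u v assume S: "S \<subseteq> a ` B" "finite S" and sum: "(\<Sum>v\<in>S. u v *\<^sub>R v) = 0" and v: "v \<in> S"
  define T where "T = {i\<in>B. a i \<in> S}"
  have ST: "S = a ` T" using S by (auto simp: T_def)
  have "(\<Sum>i\<in>T. u (a i) *\<^sub>R a i) = 0"
    using sum unfolding ST
    by (subst (asm) sum.reindex) (auto intro: inj_on_subset[OF inj_on_column_basis] simp: T_def)
  moreover have "indep_columns A T"
    using indep_columns_mono[OF basis_indep[OF basis]] by (auto simp: T_def)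
  ultimately have "\<forall>i\<in>T. u (a i) = 0"
    unfolding indep_columns_def by (elim allE[where x = "\<lambda>i. u (a i)"]) simp
  then show "u v = 0" using v ST by auto
qed

lemma affine_independent_basis_columns: "\<not> affine_dependent (a ` B)"
  using independent_basis_columns affine_dependent_imp_dependent by blast

context
  assumes co_eulerian: "co_eulerian A"
begin

text \<open>
  The sum of the coordinates is the height functional, which takes the value \<open>1\<close> on every column.
\<close>

lemma coord_sum_combination:
  "(\<Sum>e\<in>B. coord A B e (\<Sum>i\<in>UNIV. c i *\<^sub>R a i)) = (\<Sum>i\<in>UNIV. c i)"
proof -
  have "(\<Sum>e\<in>B. coord A B e (\<Sum>i\<in>UNIV. c i *\<^sub>R a i)) = (\<Sum>i\<in>UNIV. c i * (\<Sum>e\<in>B. coord A B e (a i)))"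
    unfolding coord_sum coord_scaleR sum_distrib_left by (rule sum.swap)
  then show ?thesis by (simp add: co_eulerian_coord_sum_column[OF basis co_eulerian])
qed

lemma root_polytope_coord_sum:
  assumes "x \<in> root_polytope A"
  shows "x \<in> span (range a)" and "(\<Sum>e\<in>B. coord A B e x) = 1"
proof -
  show "x \<in> span (range a)"
    using assms convex_hull_subset_span unfolding root_polytope_def by blast
  have "linear (\<lambda>x. \<Sum>e\<in>B. coord A B e x)"
    by (intro linear_compose_sum) (auto intro: linear_coord)
  then have "convex ((\<lambda>x. \<Sum>e\<in>B. coord A B e x) -` {1})"
    by (intro convex_linear_vimage) auto
  then have "convex hull (range a) \<subseteq> (\<lambda>x. \<Sum>e\<in>B. coord A B e x) -` {1}"
    by (intro hull_minimal) (auto simp: co_eulerian_coord_sum_column[OF basis co_eulerian])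
  then show "(\<Sum>e\<in>B. coord A B e x) = 1"
    using assms unfolding root_polytope_def by blast
qed

lemma basis_nonempty: "B \<noteq> {}"
  using co_eulerian_coord_sum_column[OF basis co_eulerian] by force

text \<open>
  Expansions of columns in the basis have coefficient sum \<open>1\<close>, so they are affine combinations and
  the affine hull of all columns is already spanned by \<open>B\<close>.
\<close>

lemma aff_dim_root_polytope: "aff_dim (root_polytope A) = int (card B) - 1"
proof -
  have "a i \<in> affine hull (a ` B)" for i
  proof -
    have "a i = (\<Sum>e\<in>B. coord A B e (a i) *\<^sub>R a e)"
      by (rule basis_expansion[OF basis]) (simp add: span_base)
    also have "\<dots> = (\<Sum>v\<in>a ` B. coord A B (inv_into B a v) (a i) *\<^sub>R v)"
      by (subst sum.reindex[OF inj_on_column_basis]) (simp add: inv_into_f_f[OF inj_on_column_basis])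
    finally have "a i = (\<Sum>v\<in>a ` B. coord A B (inv_into B a v) (a i) *\<^sub>R v)" .
    moreover have "(\<Sum>v\<in>a ` B. coord A B (inv_into B a v) (a i)) = 1"
      by (subst sum.reindex[OF inj_on_column_basis])
        (simp add: inv_into_f_f[OF inj_on_column_basis] co_eulerian_coord_sum_column[OF basis co_eulerian])
    ultimately show ?thesis
      by (subst affine_hull_finite) (auto intro!: exI[of _ "\<lambda>v. coord A B (inv_into B a v) (a i)"])
  qed
  then have "affine hull (range a) \<subseteq> affine hull (a ` B)"
    by (intro hull_minimal) auto
  moreover have "affine hull (a ` B) \<subseteq> affine hull (range a)" by (intro hull_mono) auto
  ultimately have "aff_dim (range a) = aff_dim (a ` B)"
    by (metis aff_dim_affine_hull subset_antisym)
  then show ?thesis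
    using aff_dim_affine_independent[OF affine_independent_basis_columns] card_image[OF inj_on_column_basis]
    by (simp add: root_polytope_def aff_dim_convex_hull)
qed

lemma basis_simplex_coord_nonneg:
  assumes "x \<in> basis_simplex A B" "e \<in> B"
  shows "coord A B e x \<ge> 0"
proof -
  have "convex (coord A B e -` {0..})" by (intro convex_linear_vimage linear_coord convex_real_interval)
  then have "convex hull (a ` B) \<subseteq> coord A B e -` {0..}"
    using assms(2) by (intro hull_minimal) (auto simp: coord_column[OF basis_indep[OF basis]])
  then show ?thesis using assms(1) unfolding basis_simplex_def by auto
qed

lemma rel_interior_basis_simplexI:
  assumes x: "x \<in> root_polytope A" and pos: "\<And>e. e \<in> B \<Longrightarrow> coord A B e x > 0"
  shows "x \<in> rel_interior (basis_simplex A B)"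
proof -
  have "(\<Sum>v\<in>a ` B. coord A B (inv_into B a v) x *\<^sub>R v) = (\<Sum>e\<in>B. coord A B e x *\<^sub>R a e)"
    by (subst sum.reindex[OF inj_on_column_basis]) (simp add: inv_into_f_f[OF inj_on_column_basis])
  moreover have "(\<Sum>v\<in>a ` B. coord A B (inv_into B a v) x) = (\<Sum>e\<in>B. coord A B e x)"
    by (subst sum.reindex[OF inj_on_column_basis]) (simp add: inv_into_f_f[OF inj_on_column_basis])
  moreover have "\<forall>v\<in>a ` B. 0 < coord A B (inv_into B a v) x"
    using pos by (auto simp: inv_into_into)
  ultimately show ?thesis
    unfolding basis_simplex_def rel_interior_convex_hull_explicit[OF affine_independent_basis_columns]
    using root_polytope_coord_sum[OF x] basis_expansion[OF basis, of x] by auto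
qed

end

end

end

section \<open>A generic vector detecting semi-passivity\<close>

text \<open>
  The position in the linear order, counted from \<open>0\<close>. It supplies distinct exponents for the weights
  of the generic vector.
\<close>

definition position :: "'m rel \<Rightarrow> 'm \<Rightarrow> nat" where
  "position r i = card {j. (j, i) \<in> r \<and> j \<noteq> i}"

lemma position_strict_mono:
  fixes r :: "'m :: finite rel"
  assumes r: "linear_order r" and ij: "(i, j) \<in> r" "i \<noteq> j"
  shows "position r i < position r j"
proof -
  have tr: "trans r" and an: "antisym r"
    using r by (auto simp: linear_order_on_def partial_order_on_def preorder_on_def)
  have "{k. (k, i) \<in> r \<and> k \<noteq> i} \<subset> {k. (k, j) \<in> r \<and> k \<noteq> j}"
    using transD[OF tr _ ij(1)] antisymD[OF an] ij by blast
  then show ?thesis unfolding position_def by (intro psubset_card_mono) auto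
qed

lemma position_inj:
  fixes r :: "'m :: finite rel"
  assumes r: "linear_order r"
  shows "inj (position r)"
proof (rule injI)
  fix i j assume eq: "position r i = position r j"
  show "i = j"
  proof (rule ccontr)
    assume "i \<noteq> j"
    then have "(i, j) \<in> r \<or> (j, i) \<in> r"
      using r by (auto simp: linear_order_on_def total_on_def)
    then show False using position_strict_mono[OF r] \<open>i \<noteq> j\<close> eq by fastforce
  qed
qed

lemma max_element:
  fixes r :: "'m :: finite rel"
  assumes r: "linear_order r" and S: "S \<noteq> {}"
  shows "max_element r S \<in> S" and "x \<in> S \<Longrightarrow> (x, max_element r S) \<in> r"
proof -
  have refl: "(x, x) \<in> r" for x
    using r by (auto simp: linear_order_on_def partial_order_on_def preorder_on_def refl_on_def)
  have an: "antisym r"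
    using r by (auto simp: linear_order_on_def partial_order_on_def)
  have "Max (position r ` S) \<in> position r ` S" using S by (intro Max_in) auto
  then obtain m where m: "m \<in> S" "Max (position r ` S) = position r m" by blast
  have le: "position r x \<le> position r m" if "x \<in> S" for x
    unfolding m(2)[symmetric] using that by (intro Max_ge) auto
  have "(x, m) \<in> r" if "x \<in> S" for x
  proof (cases "x = m")
    case False
    then have "(x, m) \<in> r \<or> (m, x) \<in> r"
      using r by (auto simp: linear_order_on_def total_on_def)
    then show ?thesis using position_strict_mono[OF r, of m x] False le[OF that] by auto
  qed (simp add: refl)
  then have "m \<in> S \<and> (\<forall>x\<in>S. (x, m) \<in> r)" using m(1) by blast
  moreover from this have "n = m" if "n \<in> S \<and> (\<forall>x\<in>S. (x, n) \<in> r)" for n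
    using that antisymD[OF an] by blast
  ultimately have "max_element r S \<in> S \<and> (\<forall>x\<in>S. (x, max_element r S) \<in> r)"
    unfolding max_element_def by (rule theI)
  then show "max_element r S \<in> S" "x \<in> S \<Longrightarrow> (x, max_element r S) \<in> r" by auto
qed

text \<open>
  A power of two exceeds the sum of all smaller ones. With coefficients \<open>0\<close> and \<open>\<plusminus>1\<close>, the largest
  element of the support therefore decides the sign.
\<close>

lemma binary_weighted_sum_sign:
  fixes r :: "'m :: finite rel" and s :: "'m \<Rightarrow> real"
  assumes r: "linear_order r" and s: "\<And>i. s i \<in> {-1, 0, 1}" and ne: "{i. s i \<noteq> 0} \<noteq> {}"
  defines "m \<equiv> max_element r {i. s i \<noteq> 0}"
  shows "0 < s m * (\<Sum>i\<in>UNIV. 2 ^ position r i * s i)"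
proof -
  define R where "R = {i. s i \<noteq> 0} - {m}"
  have m: "s m \<noteq> 0" "\<And>i. s i \<noteq> 0 \<Longrightarrow> (i, m) \<in> r"
    using max_element[OF r ne] by (auto simp: m_def)
  have "position r ` R \<subseteq> {..<position r m}"
    using position_strict_mono[OF r m(2)] by (auto simp: R_def)
  then have "(\<Sum>k\<in>position r ` R. 2 ^ k :: real) \<le> (\<Sum>k<position r m. 2 ^ k)"
    by (intro sum_mono2) auto
  also have "(\<Sum>k<n. 2 ^ k :: real) < 2 ^ n" for n by (induction n) auto
  finally have less: "(\<Sum>i\<in>R. 2 ^ position r i :: real) < 2 ^ position r m"
    by (subst (asm) sum.reindex) (auto intro: inj_on_subset[OF position_inj[OF r]])
  have ss: "s m * s m = 1" using s[of m] m(1) by auto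
  have "(\<Sum>i\<in>UNIV. 2 ^ position r i * s i) = (\<Sum>i\<in>insert m R. 2 ^ position r i * s i)"
    by (rule sum.mono_neutral_right) (auto simp: R_def)
  also have "s m * \<dots> = 2 ^ position r m + (\<Sum>i\<in>R. 2 ^ position r i * (s m * s i))"
    using ss by (subst sum.insert) (auto simp: R_def algebra_simps sum_distrib_left)
  also have "\<dots> \<ge> 2 ^ position r m + (\<Sum>i\<in>R. 2 ^ position r i * (-1))"
  proof -
    have "- 1 \<le> s m * s i" for i using s[of m] s[of i] by auto
    then show ?thesis by (intro add_left_mono sum_mono mult_left_mono) auto
  qed
  finally show ?thesis using less by (simp add: sum_negf)
qed

definition generic_vector :: "real ^ 'm ^ 'n \<Rightarrow> 'm rel \<Rightarrow> real ^ 'n" where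
  "generic_vector A r = (\<Sum>i\<in>UNIV. 2 ^ position r i *\<^sub>R column i A)"

context totally_unimodular_matrix
begin

lemma coord_generic_vector:
  assumes B: "matroid_basis A B" "e \<in> B" and r: "linear_order r"
  defines "m \<equiv> max_element r (fundamental_cocircuit A B e)"
  shows "0 < coord A B e (a m) * coord A B e (generic_vector A r)"
    and "m \<in> fundamental_cocircuit A B e"
proof -
  have C: "fundamental_cocircuit A B e = {i. coord A B e (a i) \<noteq> 0}"
    by (simp add: fundamental_cocircuit_eq[OF B] functional_support_def)
  have "e \<in> {i. coord A B e (a i) \<noteq> 0}" by (simp add: coord_self[OF B])
  then have ne: "{i. coord A B e (a i) \<noteq> 0} \<noteq> {}" by blast
  have "coord A B e (generic_vector A r) = (\<Sum>i\<in>UNIV. 2 ^ position r i * coord A B e (a i))"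
    by (simp add: generic_vector_def coord_sum coord_scaleR)
  then show "0 < coord A B e (a m) * coord A B e (generic_vector A r)"
    using binary_weighted_sum_sign[OF r coord_column_values[OF B] ne] by (simp add: m_def C)
  show "m \<in> fundamental_cocircuit A B e"
    using max_element(1)[OF r ne] by (simp add: m_def C)
qed

lemma coord_generic_vector_nonzero:
  assumes "matroid_basis A B" "e \<in> B" "linear_order r"
  shows "coord A B e (generic_vector A r) \<noteq> 0"
  using coord_generic_vector(1)[OF assms] by auto

text \<open>
  The coordinate of the generic vector at \<open>e\<close> has the sign that the maximal element of the
  fundamental cocircuit has relative to \<open>e\<close>.
\<close>

lemma internally_semi_passive_iff:
  assumes "matroid_basis A B" "linear_order r"
  shows "internally_semi_passive A r B e \<longleftrightarrow> e \<in> B \<and> coord A B e (generic_vector A r) < 0"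
proof (cases "e \<in> B")
  case True
  let ?m = "max_element r (fundamental_cocircuit A B e)"
  have "coord A B e (a ?m) < 0 \<longleftrightarrow> coord A B e (generic_vector A r) < 0"
    using coord_generic_vector(1)[OF assms(1) True assms(2)]
    by (auto simp: zero_less_mult_iff)
  then show ?thesis
    using True opposite_sign_fundamental_cocircuit_iff[OF assms(1) True
        coord_generic_vector(2)[OF assms(1) True assms(2)]]
    unfolding internally_semi_passive_def by simp
qed (simp add: internally_semi_passive_def)

end

section \<open>The half-open decomposition\<close>

text \<open>
  Equivalently, all coordinates of \<open>x + \<epsilon> q\<close> are positive for all sufficiently small \<open>\<epsilon> > 0\<close>.
\<close>

definition half_open :: "real ^ 'm ^ 'n \<Rightarrow> 'm set \<Rightarrow> real ^ 'n \<Rightarrow> real ^ 'n \<Rightarrow> bool" where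
  "half_open A B q x \<longleftrightarrow>
    (\<forall>e\<in>B. 0 < coord A B e x \<or> coord A B e x = 0 \<and> 0 < coord A B e q)"

lemma eventually_perturbation_positive:
  fixes c d :: real
  assumes "0 < c \<or> c = 0 \<and> 0 < d"
  shows "\<forall>\<^sub>F \<epsilon> in at_right 0. 0 < c + \<epsilon> * d"
  using assms
proof
  assume c: "0 < c"
  have "((\<lambda>\<epsilon>. c + \<epsilon> * d) \<longlongrightarrow> c + 0 * d) (at_right 0)" by (intro tendsto_intros)
  then show ?thesis using c by (intro order_tendstoD(1)) auto
next
  assume "c = 0 \<and> 0 < d"
  then show ?thesis by (auto intro: eventually_mono[OF eventually_at_right_less])
qed

context totally_unimodular_matrix
begin

lemma nonneg_combination_in_root_polytope:
  assumes "\<And>i. i \<in> I \<Longrightarrow> 0 \<le> c i" "(\<Sum>i\<in>I. c i) = 1"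
  shows "(\<Sum>i\<in>I. c i *\<^sub>R a i) \<in> root_polytope A"
  unfolding root_polytope_def
  using assms by (intro convex_sum) (auto intro: hull_inc)

text \<open>
  For small \<open>\<epsilon> > 0\<close> the point \<open>x + \<epsilon> q\<close> is, after rescaling to height \<open>1\<close>, a point \<open>z \<epsilon>\<close> of the
  root polytope. Existence: if no half-open cone contained \<open>x\<close>, then \<open>z \<epsilon>\<close> would have a negative
  coordinate for every basis of the dissection as soon as \<open>\<epsilon>\<close> is small, so no simplex would cover
  it. Uniqueness: if the half-open cones of \<open>B\<close> and \<open>B'\<close> both contain \<open>x\<close>, then \<open>z \<epsilon>\<close> lies in the
  relative interior of both simplices.
\<close>

lemma ex1_half_open:
  assumes ce: "co_eulerian A" and D: "dissecting_bases A D"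
    and y: "y \<in> root_polytope A" and t: "0 \<le> t"
    and q: "q = (\<Sum>i\<in>UNIV. c i *\<^sub>R a i)" and c: "\<And>i. 0 < c i"
    and generic: "\<And>B e. B \<in> D \<Longrightarrow> e \<in> B \<Longrightarrow> coord A B e q \<noteq> 0"
  shows "\<exists>!B. B \<in> D \<and> half_open A B q (t *\<^sub>R y)"
proof -
  define s where "s = (\<Sum>i\<in>UNIV. c i)"
  have s: "0 < s" unfolding s_def by (intro sum_pos) (auto simp: c)
  have basis: "matroid_basis A B" if "B \<in> D" for B
    using D that by (auto simp: dissecting_bases_def)
  define x where "x = t *\<^sub>R y"
  define z where "z \<epsilon> = (1 / (t + \<epsilon> * s)) *\<^sub>R (x + \<epsilon> *\<^sub>R q)" for \<epsilon>
  have z: "z \<epsilon> \<in> root_polytope A" if "0 < \<epsilon>" for \<epsilon>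
  proof -
    have pos: "0 < t + \<epsilon> * s" using that s t by (simp add: add_nonneg_pos)
    have "(\<Sum>i\<in>UNIV. (c i / s) *\<^sub>R a i) \<in> root_polytope A"
      using s c by (intro nonneg_combination_in_root_polytope)
        (auto simp: less_imp_le s_def sum_divide_distrib[symmetric])
    then have "(1 / s) *\<^sub>R q \<in> root_polytope A"
      by (simp add: q scaleR_sum_right)
    moreover have "convex (root_polytope A)" by (simp add: root_polytope_def)
    ultimately have "(t / (t + \<epsilon> * s)) *\<^sub>R y + (\<epsilon> * s / (t + \<epsilon> * s)) *\<^sub>R ((1 / s) *\<^sub>R q) \<in> root_polytope A"
      using y pos t s that by (intro convexD) (auto simp: add_divide_distrib[symmetric])
    also have "(t / (t + \<epsilon> * s)) *\<^sub>R y + (\<epsilon> * s / (t + \<epsilon> * s)) *\<^sub>R ((1 / s) *\<^sub>R q) = z \<epsilon>"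
      using s by (simp add: z_def x_def scaleR_add_right)
    finally show ?thesis .
  qed
  have coord_z: "coord A B e (z \<epsilon>) = (coord A B e x + \<epsilon> * coord A B e q) / (t + \<epsilon> * s)" for B e \<epsilon>
    by (simp add: z_def coord_scaleR coord_add)
  have pos: "0 < t + \<epsilon> * s" if "0 < \<epsilon>" for \<epsilon>
    using that s t by (simp add: add_nonneg_pos)
  have "\<exists>B\<in>D. half_open A B q x"
  proof (rule ccontr)
    assume "\<not> ?thesis"
    then have neg: "\<exists>e\<in>B. \<not> (0 < coord A B e x \<or> coord A B e x = 0 \<and> 0 < coord A B e q)" if "B \<in> D" for B
      using that unfolding half_open_def by blast
    have "\<forall>\<^sub>F \<epsilon> in at_right 0. \<forall>B\<in>D. \<exists>e\<in>B. coord A B e x + \<epsilon> * coord A B e q < 0"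
    proof (intro eventually_ball_finite ballI)
      fix B assume B: "B \<in> D"
      obtain e where e: "e \<in> B" "\<not> (0 < coord A B e x \<or> coord A B e x = 0 \<and> 0 < coord A B e q)"
        using neg[OF B] by blast
      \<comment> \<open>Genericity turns the negated condition into the same condition for the opposite signs.\<close>
      then have "0 < - coord A B e x \<or> - coord A B e x = 0 \<and> 0 < - coord A B e q"
        using generic[OF B e(1)] by auto
      then have "\<forall>\<^sub>F \<epsilon> in at_right 0. 0 < - coord A B e x + \<epsilon> * - coord A B e q"
        by (rule eventually_perturbation_positive)
      then show "\<forall>\<^sub>F \<epsilon> in at_right 0. \<exists>e\<in>B. coord A B e x + \<epsilon> * coord A B e q < 0"
        by eventually_elim (use e(1) in force)
    qed simp
    then have "\<forall>\<^sub>F \<epsilon> in at_right (0 :: real). False"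
      using eventually_at_right_less
    proof eventually_elim
      case (elim \<epsilon>)
      have "z \<epsilon> \<in> (\<Union>B\<in>D. basis_simplex A B)"
        using z[OF elim(2)] D by (simp add: dissecting_bases_def)
      then obtain B where B: "B \<in> D" "z \<epsilon> \<in> basis_simplex A B" by blast
      then obtain e where "e \<in> B" "coord A B e x + \<epsilon> * coord A B e q < 0" using elim(1) by blast
      then show False
        using basis_simplex_coord_nonneg[OF basis[OF B(1)] ce B(2), of e] pos[OF elim(2)]
        by (simp add: coord_z zero_le_divide_iff)
    qed
    then show False by simp
  qed
  moreover have "B = B'" if B: "B \<in> D" "half_open A B q x" and B': "B' \<in> D" "half_open A B' q x" for B B'
  proof -
    have ev: "\<forall>\<^sub>F \<epsilon> in at_right 0. \<forall>e\<in>C. 0 < coord A C e x + \<epsilon> * coord A C e q"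
      if "half_open A C q x" for C
      using that unfolding half_open_def
      by (intro eventually_ball_finite ballI eventually_perturbation_positive) auto
    have "\<forall>\<^sub>F \<epsilon> in at_right (0 :: real). 0 < \<epsilon> \<and>
        (\<forall>e\<in>B. 0 < coord A B e x + \<epsilon> * coord A B e q) \<and> (\<forall>e\<in>B'. 0 < coord A B' e x + \<epsilon> * coord A B' e q)"
      by (intro eventually_conj eventually_at_right_less ev B(2) B'(2))
    then obtain \<epsilon> where \<epsilon>: "0 < \<epsilon>" "\<forall>e\<in>B. 0 < coord A B e x + \<epsilon> * coord A B e q"
        "\<forall>e\<in>B'. 0 < coord A B' e x + \<epsilon> * coord A B' e q"
      using eventually_happens'[OF trivial_limit_at_right_real] by blast
    have "z \<epsilon> \<in> rel_interior (basis_simplex A B)" "z \<epsilon> \<in> rel_interior (basis_simplex A B')"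
      using \<epsilon> pos[OF \<epsilon>(1)] B(1) B'(1)
      by (auto intro!: rel_interior_basis_simplexI[OF _ ce] basis z simp: coord_z)
    then show ?thesis
      using D B(1) B'(1) unfolding dissecting_bases_def by blast
  qed
  ultimately show ?thesis unfolding x_def by blast
qed

end

section \<open>Counting lattice points\<close>

context totally_unimodular_matrix
begin

definition half_open_lattice_points :: "'m set \<Rightarrow> real ^ 'n \<Rightarrow> nat \<Rightarrow> (real ^ 'n) set" where
  "half_open_lattice_points B q t =
    {x \<in> (\<lambda>x. real t *\<^sub>R x) ` root_polytope A \<inter> integer_lattice. half_open A B q x}"

lemma nat_combination_in_dilation:
  assumes "(\<Sum>e\<in>I. n e) = t"
  shows "(\<Sum>e\<in>I. real (n e) *\<^sub>R a e) \<in> (\<lambda>x. real t *\<^sub>R x) ` root_polytope A \<inter> integer_lattice"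
proof
  show "(\<Sum>e\<in>I. real (n e) *\<^sub>R a e) \<in> integer_lattice"
    using column_integral by (auto simp: integer_lattice_def intro!: Ints_sum Ints_mult)
  show "(\<Sum>e\<in>I. real (n e) *\<^sub>R a e) \<in> (\<lambda>x. real t *\<^sub>R x) ` root_polytope A"
  proof (cases "t = 0")
    case True
    then have "(\<Sum>e\<in>I. real (n e) *\<^sub>R a e) = real t *\<^sub>R a undefined" using assms by simp
    moreover have "a undefined \<in> root_polytope A" by (simp add: root_polytope_def hull_inc)
    ultimately show ?thesis by blast
  next
    case False
    have "(\<Sum>e\<in>I. real (n e) / real t) = 1"
      using assms False by (simp flip: sum_divide_distrib of_nat_sum)
    then have "(\<Sum>e\<in>I. (real (n e) / real t) *\<^sub>R a e) \<in> root_polytope A"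
      by (intro nonneg_combination_in_root_polytope) auto
    moreover have "(\<Sum>e\<in>I. real (n e) *\<^sub>R a e) = real t *\<^sub>R (\<Sum>e\<in>I. (real (n e) / real t) *\<^sub>R a e)"
      using False by (simp add: scaleR_sum_right)
    ultimately show ?thesis by blast
  qed
qed

context
  fixes B :: "'m set" and q :: "real ^ 'n" and V :: "'m set"
  assumes basis: "matroid_basis A B" and co_eulerian: "co_eulerian A"
  defines "V \<equiv> {e \<in> B. \<not> 0 < coord A B e q}"
begin

text \<open>
  The set \<open>V\<close> collects the elements whose opposite facets are removed from the simplex.
  Coordinates of lattice points are integers, the half-open condition makes them nonnegative and
  positive on \<open>V\<close>, and the height functional gives their sum.
\<close>

lemma half_open_lattice_point_coords:
  assumes x: "x \<in> half_open_lattice_points B q t"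
  shows "\<exists>n. x = (\<Sum>e\<in>B. real (n e) *\<^sub>R a e) \<and> (\<forall>e\<in>V. 0 < n e) \<and> (\<Sum>e\<in>B. n e) = t"
proof -
  define n where "n e = nat \<lfloor>coord A B e x\<rfloor>" for e
  obtain y where y: "y \<in> root_polytope A" "x = real t *\<^sub>R y"
    and lat: "x \<in> integer_lattice" and ho: "half_open A B q x"
    using x unfolding half_open_lattice_points_def by blast
  have n: "real (n e) = coord A B e x" if "e \<in> B" for e
  proof -
    have "coord A B e x \<in> \<int>" by (rule coord_integral[OF basis_indep[OF basis] that lat])
    then obtain z where z: "coord A B e x = of_int z" by (elim Ints_cases)
    have "0 \<le> coord A B e x" using ho that unfolding half_open_def by force
    then show ?thesis using z by (simp add: n_def)
  qed
  have "x \<in> span (range a)"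
    using root_polytope_coord_sum(1)[OF basis co_eulerian y(1)] y(2) by (simp add: span_scale)
  then have "x = (\<Sum>e\<in>B. coord A B e x *\<^sub>R a e)" by (rule basis_expansion[OF basis])
  also have "\<dots> = (\<Sum>e\<in>B. real (n e) *\<^sub>R a e)" by (intro sum.cong) (simp_all add: n)
  finally have "x = (\<Sum>e\<in>B. real (n e) *\<^sub>R a e)" .
  have "real (\<Sum>e\<in>B. n e) = real t * (\<Sum>e\<in>B. coord A B e y)"
    by (simp add: n y(2) coord_scaleR sum_distrib_left)
  then have "real (\<Sum>e\<in>B. n e) = real t"
    by (simp only: root_polytope_coord_sum(2)[OF basis co_eulerian y(1)] mult_1_right)
  then have "(\<Sum>e\<in>B. n e) = t" by (simp only: of_nat_eq_iff)
  moreover have "0 < n e" if "e \<in> V" for e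
  proof -
    have "0 < coord A B e x" using ho that unfolding half_open_def V_def by blast
    then have "0 < real (n e)" using n[of e] that by (simp add: V_def)
    then show ?thesis by simp
  qed
  ultimately show ?thesis using \<open>x = (\<Sum>e\<in>B. real (n e) *\<^sub>R a e)\<close> by blast
qed

lemma half_open_lattice_points_nonempty_imp:
  assumes "half_open_lattice_points B q t \<noteq> {}"
  shows "card V \<le> t"
proof -
  obtain n where n: "\<forall>e\<in>V. 0 < n e" "(\<Sum>e\<in>B. n e) = t"
    using assms half_open_lattice_point_coords by blast
  have "card V = (\<Sum>e\<in>V. 1)" by simp
  also have "\<dots> \<le> (\<Sum>e\<in>V. n e)" using n(1) by (intro sum_mono) (simp add: Suc_le_eq)
  also have "\<dots> \<le> (\<Sum>e\<in>B. n e)" by (intro sum_mono2) (auto simp: V_def)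
  finally show ?thesis using n(2) by simp
qed

lemma half_open_combination:
  assumes "\<And>e. e \<in> V \<Longrightarrow> 0 < n e"
  shows "half_open A B q (\<Sum>e\<in>B. real (n e) *\<^sub>R a e)"
  unfolding half_open_def
proof
  fix e assume e: "e \<in> B"
  show "0 < coord A B e (\<Sum>e\<in>B. real (n e) *\<^sub>R a e) \<or>
      coord A B e (\<Sum>e\<in>B. real (n e) *\<^sub>R a e) = 0 \<and> 0 < coord A B e q"
    unfolding coord_combination[OF basis_indep[OF basis] e]
    using assms[of e] e by (cases "0 < n e") (auto simp: V_def)
qed

text \<open>
  Subtracting \<open>1\<close> from the coordinates in \<open>V\<close> turns the coordinate vectors into arbitrary vectors of
  natural numbers with a smaller sum, which are listed along an enumeration \<open>g\<close> of \<open>B\<close>.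
\<close>

lemma card_half_open_lattice_points_eq_lists:
  assumes "card V \<le> t"
  shows "card (half_open_lattice_points B q t) =
    card {l :: nat list. length l = card B \<and> sum_list l = t - card V}" (is "_ = card ?L")
proof -
  obtain g where g: "bij_betw g {..<card B} B"
    using ex_bij_betw_nat_finite[of B] by (auto simp: atLeast0LessThan)
  define v :: "'m \<Rightarrow> nat" where "v e = (if e \<in> V then 1 else 0)" for e
  have sum_v: "(\<Sum>e\<in>B. v e) = card V"
    by (simp add: v_def sum.If_cases V_def Int_def conj_commute)
  define h where "h = inv_into {..<card B} g"
  have hg: "h (g p) = p" if "p < card B" for p
    using g that by (simp add: h_def bij_betw_def)
  have h: "h e < card B" "g (h e) = e" if "e \<in> B" for e
  proof -
    have "e \<in> g ` {..<card B}" using g that by (simp add: bij_betw_def)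
    then show "h e < card B" "g (h e) = e"
      unfolding h_def using inv_into_into[of e g "{..<card B}"] f_inv_into_f[of e g "{..<card B}"] by auto
  qed
  define n where "n l e = l ! h e + v e" for l e
  define F where "F l = (\<Sum>e\<in>B. real (n l e) *\<^sub>R a e)" for l
  have sum_n: "(\<Sum>e\<in>B. n l e) = sum_list l + card V" if "length l = card B" for l
  proof -
    have "(\<Sum>e\<in>B. l ! h e) = (\<Sum>p<card B. l ! p)"
      using sum.reindex_bij_betw[OF g, of "\<lambda>e. l ! h e"] by (simp add: hg)
    then show ?thesis
      using that sum_v by (simp add: n_def sum.distrib sum_list_sum_nth atLeast0LessThan)
  qed
  have "bij_betw F ?L (half_open_lattice_points B q t)"
    unfolding bij_betw_def
  proof
    show "inj_on F ?L"
    proof (rule inj_onI)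
      fix l l' assume l: "l \<in> ?L" "l' \<in> ?L" and eq: "F l = F l'"
      have "l ! p = l' ! p" if "p < card B" for p
      proof -
        have e: "g p \<in> B" using g that by (auto simp: bij_betw_def)
        have "real (n l (g p)) = real (n l' (g p))"
          using arg_cong[OF eq, of "coord A B (g p)"]
          unfolding F_def coord_combination[OF basis_indep[OF basis] e] .
        then show ?thesis by (simp add: n_def hg[OF that])
      qed
      then show "l = l'" using l by (auto intro: nth_equalityI)
    qed
    show "F ` ?L = half_open_lattice_points B q t"
    proof
      show "F ` ?L \<subseteq> half_open_lattice_points B q t"
      proof (rule image_subsetI)
        fix l assume l: "l \<in> ?L"
        then have "(\<Sum>e\<in>B. n l e) = t" using sum_n[of l] assms by simp
        then have "F l \<in> (\<lambda>x. real t *\<^sub>R x) ` root_polytope A \<inter> integer_lattice"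
          unfolding F_def by (rule nat_combination_in_dilation)
        moreover have "half_open A B q (F l)"
          unfolding F_def by (rule half_open_combination) (simp add: n_def v_def)
        ultimately show "F l \<in> half_open_lattice_points B q t"
          by (simp add: half_open_lattice_points_def)
      qed
      show "half_open_lattice_points B q t \<subseteq> F ` ?L"
      proof
        fix x assume "x \<in> half_open_lattice_points B q t"
        then obtain m where m: "x = (\<Sum>e\<in>B. real (m e) *\<^sub>R a e)" "\<forall>e\<in>V. 0 < m e"
            "(\<Sum>e\<in>B. m e) = t"
          using half_open_lattice_point_coords by blast
        define l where "l = map (\<lambda>p. m (g p) - v (g p)) [0..<card B]"
        have nl: "n l e = m e" if "e \<in> B" for e
          using m(2) h[OF that] by (auto simp: n_def l_def v_def Suc_le_eq)
        then have "(\<Sum>e\<in>B. n l e) = t" using m(3) by simp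
        then have "l \<in> ?L" using sum_n[of l] by (simp add: l_def)
        moreover have "F l = x" by (simp add: F_def m(1) nl)
        ultimately show "x \<in> F ` ?L" by blast
      qed
    qed
  qed
  then show ?thesis by (simp add: bij_betw_same_card)
qed

lemma card_half_open_lattice_points:
  assumes V: "card V < card B"
  shows "card (half_open_lattice_points B q t) =
    (t + (card B - 1) - card V) choose (card B - 1)"
proof (cases "card V \<le> t")
  case True
  have "card (half_open_lattice_points B q t) = (t - card V + card B - 1) choose (t - card V)"
    by (simp only: card_half_open_lattice_points_eq_lists[OF True] card_length_sum_list)
  also have "\<dots> = (t - card V + card B - 1) choose (card B - 1)"
    using V by (subst binomial_symmetric) auto
  also have "t - card V + card B - 1 = t + (card B - 1) - card V" using V True by simp
  finally show ?thesis .
next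
  case False
  then have "half_open_lattice_points B q t = {}"
    using half_open_lattice_points_nonempty_imp by blast
  \<comment> \<open>With \<open>t < card V\<close> there is no such lattice point, and the binomial coefficient vanishes because
      its upper index is below the lower one.\<close>
  moreover have "t + (card B - 1) - card V < card B - 1" using False V by simp
  ultimately show ?thesis by (simp add: binomial_eq_0)
qed

lemma finite_half_open_lattice_points:
  assumes V: "card V < card B"
  shows "finite (half_open_lattice_points B q t)"
proof (cases "half_open_lattice_points B q t = {}")
  case False
  then have "0 < (t + (card B - 1) - card V) choose (card B - 1)"
    using half_open_lattice_points_nonempty_imp[OF False] V by (subst zero_less_binomial_iff) simp
  then show ?thesis
    unfolding card_half_open_lattice_points[OF V, symmetric] by (rule card_ge_0_finite)
qed simp

end

lemma ehrhart_root_polytope: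
  assumes ce: "co_eulerian A" and D: "dissecting_bases A D" and r: "linear_order r"
    and d: "aff_dim (root_polytope A) = int d"
  shows "ehrhart (root_polytope A) t =
      (\<Sum>B\<in>D. (t + d - card {e. internally_semi_passive A r B e}) choose d)"
    and "B \<in> D \<Longrightarrow> card {e. internally_semi_passive A r B e} \<le> d"
proof -
  define q where "q = generic_vector A r"
  define X where "X B = half_open_lattice_points B q t" for B
  let ?p = "\<lambda>B. card {e. internally_semi_passive A r B e}"
  have basis: "matroid_basis A B" if "B \<in> D" for B
    using D that by (auto simp: dissecting_bases_def)
  have cardB: "card B = Suc d" if "B \<in> D" for B
    using aff_dim_root_polytope[OF basis[OF that] ce] d by simp
  have generic: "coord A B e q \<noteq> 0" if "B \<in> D" "e \<in> B" for B e
    unfolding q_def using coord_generic_vector_nonzero[OF basis that(2) r] that(1) by blast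
  have semi_passive: "{e. internally_semi_passive A r B e} = {e \<in> B. \<not> 0 < coord A B e q}" if "B \<in> D" for B
  proof -
    have "coord A B e q < 0 \<longleftrightarrow> \<not> 0 < coord A B e q" if "e \<in> B" for e
      using generic[OF \<open>B \<in> D\<close> that] by linarith
    then show ?thesis
      unfolding internally_semi_passive_iff[OF basis[OF that] r] q_def[symmetric] by blast
  qed
  \<comment> \<open>The height of the generic vector is positive, so not all of its coordinates are negative.\<close>
  have p: "?p B < card B" if B: "B \<in> D" for B
  proof -
    have "(\<Sum>e\<in>B. coord A B e q) = (\<Sum>i\<in>UNIV. 2 ^ position r i)"
      unfolding q_def generic_vector_def by (rule coord_sum_combination[OF basis[OF B] ce])
    also have "0 < \<dots>" by (intro sum_pos) auto
    finally have "\<exists>e\<in>B. 0 < coord A B e q"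
      by (metis sum_nonpos not_le)
    then have "{e \<in> B. \<not> 0 < coord A B e q} \<subset> B" by blast
    then show ?thesis unfolding semi_passive[OF B] by (intro psubset_card_mono) auto
  qed
  then show "B \<in> D \<Longrightarrow> ?p B \<le> d" using cardB by fastforce
  have ex1: "\<exists>!B. B \<in> D \<and> half_open A B q (real t *\<^sub>R y)" if "y \<in> root_polytope A" for y
    by (rule ex1_half_open[OF ce D that _ _ _ generic, where c = "\<lambda>i. 2 ^ position r i"])
      (auto simp: q_def generic_vector_def)
  have cardX: "card (X B) = (t + d - ?p B) choose d" if "B \<in> D" for B
    using card_half_open_lattice_points[OF basis[OF that] ce, of q t] p[OF that]
    unfolding X_def semi_passive[OF that] cardB[OF that] by simp
  have finX: "finite (X B)" if "B \<in> D" for B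
    using finite_half_open_lattice_points[OF basis[OF that] ce, of q t] p[OF that]
    unfolding X_def semi_passive[OF that] .
  define Z where "Z = (\<lambda>x. real t *\<^sub>R x) ` root_polytope A \<inter> integer_lattice"
  have X: "X B = {x \<in> Z. half_open A B q x}" for B
    by (simp add: X_def half_open_lattice_points_def Z_def)
  have Z: "\<exists>!B. B \<in> D \<and> half_open A B q x" if x: "x \<in> Z" for x
  proof -
    obtain y where "y \<in> root_polytope A" "x = real t *\<^sub>R y" using x unfolding Z_def by blast
    then show ?thesis using ex1[of y] by simp
  qed
  have "\<exists>B\<in>D. half_open A B q x" if "x \<in> Z" for x
    using ex1_implies_ex[OF Z[OF that]] by blast
  then have "Z = (\<Union>B\<in>D. X B)" unfolding X by blast
  then have "ehrhart (root_polytope A) t = card (\<Union>B\<in>D. X B)" by (simp add: ehrhart_def Z_def)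
  also have "\<dots> = (\<Sum>B\<in>D. card (X B))"
  proof (rule card_UN_disjoint)
    have "B = B'" if "B \<in> D" "B' \<in> D" "x \<in> X B" "x \<in> X B'" for B B' x
      using Z[of x] that unfolding X by blast
    then show "\<forall>B\<in>D. \<forall>B'\<in>D. B \<noteq> B' \<longrightarrow> X B \<inter> X B' = {}" by blast
  qed (use finX in auto)
  also have "\<dots> = (\<Sum>B\<in>D. (t + d - ?p B) choose d)"
    by (intro sum.cong) (simp_all add: cardX)
  finally show "ehrhart (root_polytope A) t = (\<Sum>B\<in>D. (t + d - ?p B) choose d)" .
qed

end

section \<open>Reading off the coefficients\<close>

lemma sum_group_by_value:
  fixes N :: "nat \<Rightarrow> nat"
  assumes "finite D" "\<And>B. B \<in> D \<Longrightarrow> p B \<le> d"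
  shows "(\<Sum>B\<in>D. N (p B)) = (\<Sum>k\<le>d. card {B \<in> D. p B = k} * N k)"
proof -
  have "(\<Sum>B\<in>D. N (p B)) = (\<Sum>k\<le>d. \<Sum>B\<in>{B \<in> D. p B = k}. N (p B))"
    using assms by (subst sum.group) auto
  also have "\<dots> = (\<Sum>k\<le>d. card {B \<in> D. p B = k} * N k)"
    by (intro sum.cong) auto
  finally show ?thesis .
qed

text \<open>
  Evaluating at \<open>t = 0, \<dots>, d\<close> gives a unitriangular system: at \<open>t = k\<close> the binomials with index
  beyond \<open>k\<close> vanish and the one with index \<open>k\<close> is \<open>1\<close>.
\<close>

lemma h_star_basis_unique:
  fixes c c' :: "nat \<Rightarrow> real"
  assumes eq: "\<And>t. (\<Sum>k\<le>d. c k * real ((t + d - k) choose d)) = (\<Sum>k\<le>d. c' k * real ((t + d - k) choose d))"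
    and "k \<le> d"
  shows "c k = c' k"
  using \<open>k \<le> d\<close>
proof (induction k rule: less_induct)
  case (less k)
  have split: "(\<Sum>j\<le>d. f j * real ((k + d - j) choose d)) = (\<Sum>j<k. f j * real ((k + d - j) choose d)) + f k"
    for f :: "nat \<Rightarrow> real"
  proof -
    have "(\<Sum>j\<le>d. f j * real ((k + d - j) choose d)) = (\<Sum>j\<in>insert k {..<k}. f j * real ((k + d - j) choose d))"
      by (rule sum.mono_neutral_right) (use less.prems in auto)
    then show ?thesis by simp
  qed
  have "(\<Sum>j<k. c j * real ((k + d - j) choose d)) = (\<Sum>j<k. c' j * real ((k + d - j) choose d))"
    using less by (intro sum.cong) auto
  then show ?case using eq[of k] split[of c] split[of c'] by simp
qed

lemma coeff_h_star_polyI: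
  assumes d: "aff_dim P = int d"
    and eh: "\<And>t. ehrhart P t = (\<Sum>k\<le>d. c k * ((t + d - k) choose d))"
    and zero: "\<And>k. d < k \<Longrightarrow> c k = 0"
  shows "coeff (h_star_poly P) i = real (c i)"
proof -
  define p where "p = (\<Sum>k\<le>d. monom (real (c k)) k)"
  have p: "coeff p k = real (c k)" for k
    unfolding p_def coeff_sum by (simp add: zero)
  have "h_star_poly P = p"
    unfolding h_star_poly_def Let_def d nat_int
  proof (rule the_equality, intro conjI allI)
    show "degree p \<le> d" by (intro degree_le) (simp add: p zero)
    show "real (ehrhart P t) = (\<Sum>k\<le>d. coeff p k * real ((t + d - k) choose d))" for t
      by (simp add: eh p)
  next
    fix p' assume p': "degree p' \<le> d \<and> (\<forall>t. real (ehrhart P t) = (\<Sum>k\<le>d. coeff p' k * real ((t + d - k) choose d)))"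
    have "coeff p' k = coeff p k" for k
    proof (cases "k \<le> d")
      case True
      have "(\<Sum>k\<le>d. coeff p' k * real ((t + d - k) choose d)) = (\<Sum>k\<le>d. coeff p k * real ((t + d - k) choose d))" for t
        using p' by (simp add: eh p)
      then show ?thesis using True by (rule h_star_basis_unique)
    next
      case False
      then show ?thesis using p' by (simp add: p zero coeff_eq_0)
    qed
    then show "p' = p" by (rule poly_eqI)
  qed
  then show ?thesis by (simp add: p)
qed

theorem theorem5p4:
  fixes A :: "real ^ 'm ^ 'n"
    and D :: "'m set set"
    and r :: "'m rel"
    and i :: nat
  assumes "totally_unimodular A"
    and "co_eulerian A"
    and "dissecting_bases A D"
    and "linear_order r"
  shows "coeff (h_star_poly (root_polytope A)) i =
    real (card {B \<in> D. card {e. internally_semi_passive A r B e} = i})"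
proof -
  interpret totally_unimodular_matrix A by unfold_locales (rule assms(1))
  have "a undefined \<in> root_polytope A" by (simp add: root_polytope_def hull_inc)
  then obtain B where "B \<in> D" using assms(3) by (auto simp: dissecting_bases_def)
  then have B: "matroid_basis A B" using assms(3) by (simp add: dissecting_bases_def)
  define d where "d = card B - 1"
  have "0 < card B" using basis_nonempty[OF B assms(2)] by (simp add: card_gt_0_iff)
  then have d: "aff_dim (root_polytope A) = int d"
    using aff_dim_root_polytope[OF B assms(2)] by (simp add: d_def)
  note le = ehrhart_root_polytope(2)[OF assms(2-4) d]
  show ?thesis
  proof (rule coeff_h_star_polyI[OF d])
    show "ehrhart (root_polytope A) t = (\<Sum>k\<le>d. card {B \<in> D. card {e. internally_semi_passive A r B e} = k} *
        ((t + d - k) choose d))" for t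
      unfolding ehrhart_root_polytope(1)[OF assms(2-4) d] by (rule sum_group_by_value) (auto intro: le)
    show "card {B \<in> D. card {e. internally_semi_passive A r B e} = k} = 0" if "d < k" for k
      using le that by force
  qed
qed

end
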